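(* Assume (A1) and (A2), and let $\{x_t\}$, $\{\lambda_t\}$ be generated by the M-CRM (Algorithm 1). Then $$\lim_{t\to+\infty}\|x_t-x_{t-1}\|=0,\qquad \lim_{t\to+\infty}\Big\|\sum_{j\in\mathcal J}(\lambda_t)_j\nabla F_j(x_t)\Big\|=0.$$ As a consequence, all limit points of $\{x_t\}$, if any, are Pareto critical for $\min_{x\in\mathbb R^n}F(x)$.
   Context: Setting: $F=(F_1,\dots,F_m):\mathbb R^n\to\mathbb R^m$ is twice continuously differentiable, $\mathcal J=\{1,\dots,m\}$; $\|\cdot\|$ is the Euclidean norm and the induced operator norm. (A1): for every $j\in\mathcal J$, $\|\nabla^2F_j(y)-\nabla^2F_j(z)\|\le L_j\|y-z\|$ for all $y,z\in\mathbb R^n$; $L:=\max_{j}L_j$. (A2): for every $j\in\mathcal J$ there is $F_j^*\in\mathbb R$ with $F_j(y)\ge F_j^*$ for all $y\in\mathbb R^n$. A point $x^*$ is Pareto critical if $\max_{j\in\mathcal J}\langle\nabla F_j(x^* ),y-x^*\rangle\ge0$ for all $y\in\mathbb R^n$. Given approximations $\nabla\bar F_j(x)\in\mathbb R^n$ of $\nabla F_j(x)$ and symmetric $\nabla^2\bar F_j(x)\in\mathbb R^{n\times n}$ of $\nabla^2F_j(x)$, set $E^G_j(x):=\nabla F_j(x)-\nabla\bar F_j(x)$, $E^H_j(x):=\nabla^2F_j(x)-\nabla^2\bar F_j(x)$, and for $\sigma>0$ $$M^j_{x,\sigma}(y):=\langle\nabla\bar F_j(x),y-x\rangle+\tfrac12\langle\nabla^2\bar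 F_j(x)(y-x),y-x\rangle+\tfrac{\sigma}{6}\|y-x\|^3,\qquad M_{x,\sigma}(y):=\max_{j\in\mathcal J}M^j_{x,\sigma}(y).$$ Algorithm 1 (M-CRM). Step 0: choose $x_0,x_1\in\mathbb R^n$, $\sigma_1>0$, $\theta\ge0$, $\alpha>1$, $\bar\kappa_G,\bar\kappa_H\ge0$; set $t:=1$. Step 1: let $i\ge0$ be the smallest integer with $\alpha^{i-1}\sigma_t\ge\sigma_1$. Step 1.1: for every $j$ choose $\nabla\bar F_j(x_t),\nabla^2\bar F_j(x_t)$ with $\|E^G_j(x_t)\|\le\frac{\bar\kappa_G}{\alpha^{i-1}}\|x_t-x_{t-1}\|^2$ and $\|E^H_j(x_t)\|\le\frac{\bar\kappa_H}{\alpha^{i-1}}\|x_t-x_{t-1}\|$. Step 1.2: compute $(x^+_{t,i},\lambda^+_{t,i})\in\mathbb R^n\times\mathbb R^m_+$ with $M_{x_t,\alpha^i\sigma_t}(x^+_{t,i})\le0$, $\sum_j(\lambda^+_{t,i})_j=1$, and $\big\|\sum_j(\lambda^+_{t,i})_j\nabla M^j_{x_t,\alpha^i\sigma_t}(x^+_{t,i})\big\|\le\theta\|x^+_{t,i}-x_t\|^2$. Step 1.3: if $F_j(x_t)-F_j(x^+_{t,i})\ge\frac{\alpha^i\sigma_t}{12}\|x^+_{t,i}-x_t\|^3-\frac{\sigma_t}{12}\|x_t-x_{t-1}\|^3$ for all $j\in\mathcal J$, set $i_t=i$ and go to Step 2; otherwise set $i:=i+1$ and go to Step 1.1. Step 2: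 set $x_{t+1}=x^+_{t,i_t}$, $\lambda_{t+1}=\lambda^+_{t,i_t}$, $\sigma_{t+1}=\alpha^{i_t-1}\sigma_t$, $t:=t+1$, and go to Step 1. *)

theory Defs
  imports "HOL-Analysis.Analysis"
begin

text \<open>
  Vectors of \<open>\<real>\<^sup>n\<close> have type \<open>real ^ 'n\<close>, and the index set of the objectives is the whole
  finite (nonempty) type \<open>'m\<close>. The norm on matrices is always the operator norm
  \<open>onorm ((*v) A)\<close>; the type class norm of \<open>real ^ 'n ^ 'n\<close> is the Frobenius norm.
\<close>

definition grad :: "(real ^ 'n \<Rightarrow> real) \<Rightarrow> real ^ 'n \<Rightarrow> real ^ 'n" where
  "grad f x = (THE D. GDERIV f x :> D)"

definition hess :: "(real ^ 'n \<Rightarrow> real) \<Rightarrow> real ^ 'n \<Rightarrow> real ^ 'n ^ 'n" where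
  "hess f x = matrix (frechet_derivative (grad f) (at x))"

definition twice_cont_diff :: "(real ^ 'n \<Rightarrow> real) \<Rightarrow> bool" where
  "twice_cont_diff f \<longleftrightarrow>
     (\<forall>x. f differentiable (at x)) \<and> (\<forall>x. grad f differentiable (at x)) \<and>
     continuous_on UNIV (hess f)"

lemma grad_eq: "GDERIV f x :> D \<Longrightarrow> grad f x = D"
proof -
  assume D: "GDERIV f x :> D"
  have "D' = D" if "GDERIV f x :> D'" for D'
  proof -
    have "(\<lambda>h. h \<bullet> D') = (\<lambda>h. h \<bullet> D)"
      using that D unfolding gderiv_def by (rule has_derivative_unique)
    then show "D' = D" by (metis inner_commute vector_eq_rdot)
  qed
  with D show ?thesis unfolding grad_def by blast
qed

lemma differentiable_imp_gderiv_grad: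
  assumes "f differentiable (at x)"
  shows "GDERIV f x :> grad f x"
proof -
  obtain f' where f': "(f has_derivative f') (at x)"
    using assms unfolding differentiable_def by blast
  then have "linear f'" by (rule has_derivative_linear)
  then have "f' = (\<lambda>h. h \<bullet> adjoint f' 1)"
    using adjoint_works[of f' _ 1] by (auto simp: fun_eq_iff)
  with f' have "GDERIV f x :> adjoint f' 1" unfolding gderiv_def by simp
  then show ?thesis using grad_eq by metis
qed

lemma hess_eq:
  assumes "(grad f has_derivative ((*v) A)) (at x)"
  shows "hess f x = A"
  using frechet_derivative_at[OF assms] unfolding hess_def
  by (metis matrix_of_matrix_vector_mul)

definition pareto_critical :: "(real ^ 'n \<Rightarrow> real ^ 'm) \<Rightarrow> real ^ 'n \<Rightarrow> bool" where
  "pareto_critical F xs \<longleftrightarrow>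
     (\<forall>y. (MAX j. grad (\<lambda>z. F z $ j) xs \<bullet> (y - xs)) \<ge> 0)"

definition model ::
  "real ^ 'n \<Rightarrow> real ^ 'n ^ 'n \<Rightarrow> real ^ 'n \<Rightarrow> real \<Rightarrow> real ^ 'n \<Rightarrow> real" where
  "model g H x \<sigma> y =
     g \<bullet> (y - x) + 1 / 2 * ((H *v (y - x)) \<bullet> (y - x)) + \<sigma> / 6 * norm (y - x) ^ 3"

text \<open>
  One inner iteration with exponent \<open>i\<close>: \<open>xp\<close> and \<open>xc\<close> are the previous and the current outer
  iterates, \<open>\<sigma>\<close> is the current parameter, \<open>G\<close> and \<open>H\<close> are the approximate gradients and Hessians
  at \<open>xc\<close>, and \<open>(y, \<mu>)\<close> is the computed trial pair. The exponent \<open>i - 1\<close> equals \<open>-1\<close> for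
  \<open>i = 0\<close>, hence the integer power.
\<close>

definition mcrm_derivatives_ok ::
  "(real ^ 'n \<Rightarrow> real ^ 'm) \<Rightarrow> real \<Rightarrow> real \<Rightarrow> real \<Rightarrow> real ^ 'n \<Rightarrow> real ^ 'n \<Rightarrow> nat \<Rightarrow>
   ('m \<Rightarrow> real ^ 'n) \<Rightarrow> ('m \<Rightarrow> real ^ 'n ^ 'n) \<Rightarrow> bool" where
  "mcrm_derivatives_ok F \<alpha> \<kappa>G \<kappa>H xp xc i G H \<longleftrightarrow>
     (\<forall>j. transpose (H j) = H j \<and>
          norm (grad (\<lambda>z. F z $ j) xc - G j)
            \<le> \<kappa>G / \<alpha> powi (int i - 1) * norm (xc - xp) ^ 2 \<and>
          onorm ((*v) (hess (\<lambda>z. F z $ j) xc - H j))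
            \<le> \<kappa>H / \<alpha> powi (int i - 1) * norm (xc - xp))"

definition mcrm_step_ok ::
  "real \<Rightarrow> real \<Rightarrow> real ^ 'n \<Rightarrow> real \<Rightarrow> nat \<Rightarrow>
   ('m \<Rightarrow> real ^ 'n) \<Rightarrow> ('m \<Rightarrow> real ^ 'n ^ 'n) \<Rightarrow> real ^ 'n \<Rightarrow> real ^ 'm \<Rightarrow> bool" where
  "mcrm_step_ok \<theta> \<alpha> xc \<sigma> i G H y \<mu> \<longleftrightarrow>
     (MAX j. model (G j) (H j) xc (\<alpha> ^ i * \<sigma>) y) \<le> 0 \<and>
     (\<forall>j. \<mu> $ j \<ge> 0) \<and> (\<Sum>j\<in>UNIV. \<mu> $ j) = 1 \<and>
     norm (\<Sum>j\<in>UNIV. \<mu> $ j *\<^sub>R grad (model (G j) (H j) xc (\<alpha> ^ i * \<sigma>)) y)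
       \<le> \<theta> * norm (y - xc) ^ 2"

definition mcrm_accept ::
  "(real ^ 'n \<Rightarrow> real ^ 'm) \<Rightarrow> real \<Rightarrow> real ^ 'n \<Rightarrow> real ^ 'n \<Rightarrow> real \<Rightarrow> nat \<Rightarrow> real ^ 'n \<Rightarrow> bool" where
  "mcrm_accept F \<alpha> xp xc \<sigma> i y \<longleftrightarrow>
     (\<forall>j. F xc $ j - F y $ j
          \<ge> \<alpha> ^ i * \<sigma> / 12 * norm (y - xc) ^ 3 - \<sigma> / 12 * norm (xc - xp) ^ 3)"

definition mcrm_first_index :: "real \<Rightarrow> real \<Rightarrow> real \<Rightarrow> nat" where
  "mcrm_first_index \<alpha> \<sigma>1 \<sigma> = (LEAST i. \<alpha> powi (int i - 1) * \<sigma> \<ge> \<sigma>1)"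

text \<open>
  Infinite runs of the algorithm. The arrays \<open>G t k\<close>, \<open>H t k\<close>, \<open>y t k\<close>, \<open>\<mu> t k\<close> hold the data of
  the \<open>k\<close>-th inner trial of iteration \<open>t\<close>, and \<open>it t\<close> is the accepted index. Only \<open>\<sigma> t\<close> for
  \<open>t \<ge> 1\<close> and \<open>lam t\<close> for \<open>t \<ge> 2\<close> are meaningful; other entries are unconstrained.
\<close>

definition mcrm_generates ::
  "(real ^ 'n \<Rightarrow> real ^ 'm) \<Rightarrow> real \<Rightarrow> real \<Rightarrow> real \<Rightarrow> real \<Rightarrow>
   (nat \<Rightarrow> real ^ 'n) \<Rightarrow> (nat \<Rightarrow> real ^ 'm) \<Rightarrow> (nat \<Rightarrow> real) \<Rightarrow> bool" where
  "mcrm_generates F \<theta> \<alpha> \<kappa>G \<kappa>H x lam \<sigma> \<longleftrightarrow>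
     \<sigma> 1 > 0 \<and> \<theta> \<ge> 0 \<and> \<alpha> > 1 \<and> \<kappa>G \<ge> 0 \<and> \<kappa>H \<ge> 0 \<and>
     (\<exists>(it :: nat \<Rightarrow> nat) G H y \<mu>. \<forall>t\<ge>1.
        mcrm_first_index \<alpha> (\<sigma> 1) (\<sigma> t) \<le> it t \<and>
        (\<forall>k\<in>{mcrm_first_index \<alpha> (\<sigma> 1) (\<sigma> t)..it t}.
           mcrm_derivatives_ok F \<alpha> \<kappa>G \<kappa>H (x (t - 1)) (x t) k (G t k) (H t k) \<and>
           mcrm_step_ok \<theta> \<alpha> (x t) (\<sigma> t) k (G t k) (H t k) (y t k) (\<mu> t k) \<and>
           (mcrm_accept F \<alpha> (x (t - 1)) (x t) (\<sigma> t) k (y t k) \<longleftrightarrow> k = it t)) \<and>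
        x (t + 1) = y t (it t) \<and> lam (t + 1) = \<mu> t (it t) \<and>
        \<sigma> (t + 1) = \<alpha> powi (int (it t) - 1) * \<sigma> t)"

end

theory Submission
  imports Defs
begin

text \<open>
  The acceptance test makes \<open>F (x t) $ j + \<sigma> t / 12 * norm (x t - x (t - 1)) ^ 3\<close> a Lyapunov
  function: since \<open>\<alpha> ^ it t * \<sigma> t = \<alpha> * \<sigma> (t + 1)\<close> and \<open>\<sigma> t \<ge> \<sigma> 1\<close>, each iteration decreases it
  by at least \<open>(\<alpha> - 1) * \<sigma> 1 / 12\<close> times the cube of the new step length, so the steps tend to
  zero. A trial whose parameter \<open>\<alpha> ^ k * \<sigma> t\<close> exceeds a fixed threshold is always accepted, by
  Taylor's formula and a Young-type inequality that splits the derivative errors between the cubes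
  of the old and the new step. Hence \<open>\<sigma>\<close> is bounded, and approximate stationarity of the model
  bounds the convex combination of the gradients by a constant times the squared step lengths.
  At a limit point that is not Pareto critical, one direction would be a uniform descent direction
  for all objectives nearby, and so for every convex combination of the gradients.
\<close>

section \<open>Second-order calculus and Taylor bounds\<close>

lemma twice_cont_diff_imp_gderiv:
  "twice_cont_diff f \<Longrightarrow> (f has_derivative (\<lambda>h. h \<bullet> grad f x)) (at x)"
  using differentiable_imp_gderiv_grad[of f x] by (simp add: twice_cont_diff_def gderiv_def)

lemma twice_cont_diff_imp_grad_has_derivative:
  assumes "twice_cont_diff f"
  shows "(grad f has_derivative (*v) (hess f x)) (at x)"
proof -
  have D: "(grad f has_derivative frechet_derivative (grad f) (at x)) (at x)"
    using assms frechet_derivative_works by (auto simp: twice_cont_diff_def)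
  then have "(*v) (hess f x) = frechet_derivative (grad f) (at x)"
    unfolding hess_def
    by (intro ext matrix_works linear_matrix_vector_mul_eq[THEN iffD2] has_derivative_linear)
  with D show ?thesis by simp
qed

lemma norm_matrix_vector_le_onorm:
  fixes A :: "real ^ 'n ^ 'k"
  shows "norm (A *v v) \<le> onorm ((*v) A) * norm v"
  by (rule onorm) (rule matrix_vector_mul_bounded_linear)

lemma abs_quadratic_form_le_onorm:
  fixes A :: "real ^ 'n ^ 'n"
  shows "\<bar>(A *v v) \<bullet> v\<bar> \<le> onorm ((*v) A) * norm v ^ 2"
proof -
  have "\<bar>(A *v v) \<bullet> v\<bar> \<le> norm (A *v v) * norm v" by (rule Cauchy_Schwarz_ineq2)
  also have "\<dots> \<le> onorm ((*v) A) * norm v * norm v"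
    by (intro mult_right_mono norm_matrix_vector_le_onorm) simp
  finally show ?thesis by (simp add: power2_eq_square mult.assoc)
qed

text \<open>Mean value inequality for \<open>grad f z - hess f x *v z\<close>, whose derivative on
  the segment has operator norm at most \<open>L * norm (y - x)\<close>. Bounding it by its largest
  value gives the constant \<open>L\<close> rather than the sharp \<open>L / 2\<close>.\<close>

lemma gradient_taylor_bound:
  assumes f: "twice_cont_diff f"
    and L: "\<And>y z. onorm ((*v) (hess f y - hess f z)) \<le> L * norm (y - z)"
    and "0 \<le> L"
  shows "norm (grad f y - grad f x - hess f x *v (y - x)) \<le> L * norm (y - x) ^ 2"
proof -
  let ?\<phi> = "\<lambda>z. grad f z - hess f x *v z"
  have "norm (?\<phi> y - ?\<phi> x) \<le> L * norm (y - x) * norm (y - x)"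
  proof (rule differentiable_bound[of "closed_segment x y"])
    show "(?\<phi> has_derivative (*v) (hess f z - hess f x)) (at z within closed_segment x y)" for z
    proof -
      have "(?\<phi> has_derivative (\<lambda>h. hess f z *v h - hess f x *v h)) (at z)"
        by (intro has_derivative_diff twice_cont_diff_imp_grad_has_derivative f
            bounded_linear_imp_has_derivative matrix_vector_mul_bounded_linear)
      then have "(?\<phi> has_derivative (*v) (hess f z - hess f x)) (at z)"
        by (rule has_derivative_eq_rhs) (simp add: fun_eq_iff matrix_vector_mult_diff_rdistrib)
      then show ?thesis by (rule has_derivative_at_withinI)
    qed
    show "onorm ((*v) (hess f z - hess f x)) \<le> L * norm (y - x)"
      if "z \<in> closed_segment x y" for z
      using L[of z x] mult_left_mono[OF segment_bound1[OF that] \<open>0 \<le> L\<close>] by linarith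
  qed auto
  then show ?thesis
    by (simp add: algebra_simps power2_eq_square matrix_vector_mult_diff_distrib)
qed

text \<open>The Lagrange remainder along the segment gives \<open>L / 2\<close> instead of the sharp \<open>L / 6\<close>; the
  constant is irrelevant for the limits.\<close>

lemma cubic_taylor_upper_bound:
  assumes f: "twice_cont_diff f"
    and L: "\<And>y z. onorm ((*v) (hess f y - hess f z)) \<le> L * norm (y - z)"
    and "0 \<le> L"
  shows "f y \<le> f x + grad f x \<bullet> (y - x) + 1 / 2 * ((hess f x *v (y - x)) \<bullet> (y - x))
               + L / 2 * norm (y - x) ^ 3"
proof -
  define s where "s = y - x"
  define p where "p = (\<lambda>u. x + u *\<^sub>R s)"
  have p: "(p has_derivative (\<lambda>h. h *\<^sub>R s)) (at u)" for u
    unfolding p_def by (auto intro!: derivative_eq_intros)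
  \<comment> \<open>The derivatives of \<open>f\<close> along the segment, packed into the indexed
    family that \<open>Maclaurin\<close> expects; only the indices 0, 1 and 2 matter.\<close>
  define D where "D = (\<lambda>k::nat. if k = 0 then (\<lambda>u. f (p u))
    else if k = 1 then (\<lambda>u. s \<bullet> grad f (p u)) else (\<lambda>u. s \<bullet> (hess f (p u) *v s)))"
  have "((\<lambda>u. f (p u)) has_derivative (\<lambda>h. (h *\<^sub>R s) \<bullet> grad f (p u))) (at u)" for u
    using has_derivative_compose[OF p twice_cont_diff_imp_gderiv[OF f]] .
  then have D0: "(D 0 has_real_derivative D 1 u) (at u)" for u
    unfolding D_def has_field_derivative_def by (simp add: mult_commute_abs)
  have "((\<lambda>u. grad f (p u)) has_derivative (\<lambda>h. hess f (p u) *v (h *\<^sub>R s))) (at u)" for u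
    using has_derivative_compose[OF p twice_cont_diff_imp_grad_has_derivative[OF f]] .
  then have "((\<lambda>u. s \<bullet> grad f (p u)) has_derivative (\<lambda>h. s \<bullet> (hess f (p u) *v (h *\<^sub>R s)))) (at u)" for u
    by (rule has_derivative_inner_right)
  then have D1: "(D 1 has_real_derivative D 2 u) (at u)" for u
    unfolding D_def has_field_derivative_def
    by (simp add: matrix_vector_mult_scaleR mult_commute_abs)
  have "\<exists>u>0. u < 1 \<and> D 0 1 = (\<Sum>m<2. D m 0 / fact m * 1 ^ m) + D 2 u / fact 2 * 1 ^ 2"
  proof (rule Maclaurin)
    show "\<forall>m t. m < 2 \<and> 0 \<le> t \<and> t \<le> 1 \<longrightarrow> DERIV (D m) t :> D (Suc m) t"
      using D0 D1 by (auto simp: less_2_cases_iff simp flip: numeral_2_eq_2)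
  qed auto
  then obtain u where u: "0 < u" "u < 1" "D 0 1 = D 0 0 + D 1 0 + D 2 u / 2"
    by (auto simp: numeral_2_eq_2)
  have "D 2 u - D 2 0 = ((hess f (p u) - hess f (p 0)) *v s) \<bullet> s"
    by (simp add: D_def matrix_vector_mult_diff_rdistrib inner_diff_right inner_commute[of _ s])
  also have "\<dots> \<le> onorm ((*v) (hess f (p u) - hess f (p 0))) * norm s ^ 2"
    using abs_quadratic_form_le_onorm[of "hess f (p u) - hess f (p 0)" s] by linarith
  also have "\<dots> \<le> (L * norm (p u - p 0)) * norm s ^ 2"
    by (intro mult_right_mono L) simp
  also have "\<dots> = u * (L * norm s ^ 3)"
    using u by (simp add: p_def power2_eq_square power3_eq_cube)
  also have "\<dots> \<le> 1 * (L * norm s ^ 3)"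
    using u \<open>0 \<le> L\<close> by (intro mult_right_mono) auto
  finally show ?thesis
    using u by (simp add: D_def p_def s_def inner_commute)
qed

section \<open>Gradient of the cubic model\<close>

text \<open>The norm has a kink at \<open>y = x\<close>, so the chain rule works only away from it.
  At the kink the difference quotient is the squared norm of the increment, which vanishes in the
  limit.\<close>

lemma gderiv_norm_cubed:
  fixes x y :: "'a::real_inner"
  shows "((\<lambda>z. norm (z - x) ^ 3) has_derivative (\<lambda>h. h \<bullet> ((3 * norm (y - x)) *\<^sub>R (y - x)))) (at y)"
proof (cases "y = x")
  case True
  have "((\<lambda>h. norm (norm h ^ 3) / norm h) \<longlongrightarrow> 0) (at (0::'a))"
  proof (rule Lim_transform_eventually)
    show "((\<lambda>h. norm h ^ 2) \<longlongrightarrow> 0) (at (0::'a))"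
      by (auto intro!: tendsto_eq_intros)
    show "\<forall>\<^sub>F h in at (0::'a). norm h ^ 2 = norm (norm h ^ 3) / norm h"
      by (auto simp: eventually_at power2_eq_square power3_eq_cube intro!: exI[of _ 1])
  qed
  with True show ?thesis by (simp add: has_derivative_at)
next
  case False
  have "((\<lambda>z. z - x) has_derivative (\<lambda>h. h)) (at y)"
    by (auto intro!: derivative_eq_intros)
  then have "((\<lambda>z. norm (z - x)) has_derivative (\<lambda>h. h \<bullet> sgn (y - x))) (at y)"
    using False by (intro has_derivative_compose[OF _ has_derivative_norm]) auto
  from has_derivative_power[OF this, of 3] False show ?thesis
    by (auto elim!: has_derivative_eq_rhs simp: fun_eq_iff sgn_div_norm power2_eq_square)
qed

text \<open>Symmetry of \<open>H\<close> merges the two product-rule terms of the quadratic form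
  into \<open>H *v (y - x)\<close>.\<close>

lemma grad_model:
  assumes "transpose H = H"
  shows "grad (model g H x \<sigma>) y = g + H *v (y - x) + (\<sigma> / 2 * norm (y - x)) *\<^sub>R (y - x)"
proof (rule grad_eq)
  have sym: "(H *v v) \<bullet> w = v \<bullet> (H *v w)" for v w
    using assms dot_lmul_matrix[of v H w] by (metis transpose_matrix_vector)
  have diff: "((\<lambda>z. z - x) has_derivative (\<lambda>h. h)) (at y)"
    by (auto intro!: derivative_eq_intros)
  note mv = bounded_linear.has_derivative[OF matrix_vector_mul_bounded_linear[of H] diff]
  have "(model g H x \<sigma> has_derivative (\<lambda>h. g \<bullet> h
      + 1 / 2 * ((H *v (y - x)) \<bullet> h + (H *v h) \<bullet> (y - x))
      + \<sigma> / 6 * (h \<bullet> ((3 * norm (y - x)) *\<^sub>R (y - x))))) (at y)"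
    unfolding model_def
    by (intro has_derivative_add has_derivative_inner_right has_derivative_mult_right
        has_derivative_inner mv diff gderiv_norm_cubed)
  then show "GDERIV (model g H x \<sigma>) y :> g + H *v (y - x) + (\<sigma> / 2 * norm (y - x)) *\<^sub>R (y - x)"
    unfolding gderiv_def
    by (rule has_derivative_eq_rhs)
       (simp add: fun_eq_iff inner_add_right sym inner_commute[of g] inner_commute[of "y - x"])
qed

section \<open>Acceptance of trials with a large parameter\<close>

text \<open>The mixed terms are charged to one cube only, depending on the ratio of \<open>d\<close>
  and \<open>s\<close>. If \<open>d \<le> r * s\<close>, replacing \<open>d\<close> by
  \<open>r * s\<close> gives a multiple of \<open>s ^ 3\<close>; otherwise both terms are at most
  \<open>(p + q) * s * d ^ 2\<close>, and \<open>r * s < d\<close> leads to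
  \<open>c * d ^ 3\<close>. The coefficient of \<open>d ^ 3\<close> is thus prescribed in
  advance.\<close>

lemma cubic_young:
  fixes p q c d r s :: real
  assumes "0 \<le> p" "0 \<le> q" "0 \<le> c" "0 \<le> d" "0 \<le> s" "1 \<le> r" and pq: "p + q \<le> c * r"
  shows "p * d ^ 2 * s + q * d * s ^ 2 \<le> c * d ^ 3 + (p * r ^ 2 + q * r) * s ^ 3"
proof (cases "d \<le> r * s")
  case True
  have "p * d ^ 2 * s \<le> p * (r * s) ^ 2 * s" "q * d * s ^ 2 \<le> q * (r * s) * s ^ 2"
    using assms True by (intro mult_right_mono mult_left_mono power_mono; simp)+
  moreover have "0 \<le> c * d ^ 3" using assms by simp
  ultimately show ?thesis by (simp add: algebra_simps power2_eq_square power3_eq_cube)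
next
  case False
  \<comment> \<open>With \<open>1 \<le> r\<close>, the case assumption \<open>r * s < d\<close> also
    gives \<open>s \<le> d\<close>, which handles the \<open>q\<close> term.\<close>
  have "s \<le> r * s" using mult_right_mono[of 1 r s] assms by simp
  then have "s \<le> d" using False by simp
  then have "q * d * s ^ 2 \<le> q * d * (s * d)"
    using assms by (intro mult_left_mono) (auto simp: power2_eq_square intro!: mult_left_mono)
  then have "p * d ^ 2 * s + q * d * s ^ 2 \<le> (p + q) * s * d ^ 2"
    by (simp add: algebra_simps power2_eq_square)
  also have "\<dots> \<le> c * r * s * d ^ 2"
    using assms by (intro mult_right_mono) auto
  also have "\<dots> = c * (r * s) * d ^ 2" by simp
  also have "\<dots> \<le> c * d * d ^ 2"
    using assms False by (intro mult_right_mono mult_left_mono) auto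
  finally have "p * d ^ 2 * s + q * d * s ^ 2 \<le> c * d ^ 3"
    by (simp add: power2_eq_square power3_eq_cube)
  moreover have "0 \<le> (p * r ^ 2 + q * r) * s ^ 3" using assms by simp
  ultimately show ?thesis by linarith
qed

lemma mcrm_first_index_le:
  assumes "\<alpha> > 1" "\<sigma> > 0"
  shows "\<sigma>1 \<le> \<alpha> powi (int (mcrm_first_index \<alpha> \<sigma>1 \<sigma>) - 1) * \<sigma>"
proof -
  obtain n where "\<sigma>1 / \<sigma> < \<alpha> ^ n" using real_arch_pow[OF \<open>\<alpha> > 1\<close>] by blast
  then have "\<sigma>1 \<le> \<alpha> powi (int (Suc n) - 1) * \<sigma>" using assms by (simp add: field_simps)
  then show ?thesis
    unfolding mcrm_first_index_def by (rule LeastI[of "\<lambda>i. \<sigma>1 \<le> \<alpha> powi (int i - 1) * \<sigma>"])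
qed

lemma mcrm_first_index_le_mono:
  assumes "\<alpha> > 1" "\<sigma> > 0" "mcrm_first_index \<alpha> \<sigma>1 \<sigma> \<le> i"
  shows "\<sigma>1 \<le> \<alpha> powi (int i - 1) * \<sigma>"
proof -
  have "\<alpha> powi (int (mcrm_first_index \<alpha> \<sigma>1 \<sigma>) - 1) \<le> \<alpha> powi (int i - 1)"
    using assms by (intro power_int_increasing) auto
  then show ?thesis
    using mcrm_first_index_le[OF assms(1,2), of \<sigma>1] mult_right_mono[of _ _ \<sigma>] assms(2)
    by (meson order.trans less_imp_le)
qed

text \<open>By minimality the preceding exponent fails the test, and one more factor \<alpha> is all
  that is gained. This bounds the next parameter when the first trial is accepted at a positive
  exponent.\<close>

lemma mcrm_first_index_Suc_less:
  assumes "\<alpha> > 1" "mcrm_first_index \<alpha> \<sigma>1 \<sigma> = Suc k"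
  shows "\<alpha> powi (int (Suc k) - 1) * \<sigma> < \<alpha> * \<sigma>1"
proof -
  have "\<not> \<sigma>1 \<le> \<alpha> powi (int k - 1) * \<sigma>"
    using assms(2) not_less_Least[of k "\<lambda>i. \<sigma>1 \<le> \<alpha> powi (int i - 1) * \<sigma>"]
    by (simp add: mcrm_first_index_def)
  moreover have "\<alpha> powi (int (Suc k) - 1) = \<alpha> * \<alpha> powi (int k - 1)"
    using assms(1) power_int_add_1'[of \<alpha> "int k - 1"] by simp
  ultimately show ?thesis using assms(1) by simp
qed

text \<open>The factor is the \<open>r\<close> of \<open>cubic_young\<close> for \<open>c = \<sigma> / 12\<close>, where \<open>\<sigma>1 \<le> \<alpha> powi (i - 1) * \<sigma>\<close>
  turns the error coefficients into multiples of \<open>\<sigma> / \<sigma>1\<close>.\<close>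

definition mcrm_growth_factor :: "real \<Rightarrow> real \<Rightarrow> real \<Rightarrow> real" where
  "mcrm_growth_factor \<sigma>1 \<kappa>G \<kappa>H = 1 + 12 * (\<kappa>G + \<kappa>H) / \<sigma>1"

text \<open>Twelve times the coefficient that the errors put on the cube of the new step: the terms
  from \<open>cubic_young\<close>, made independent of the exponent by the factor \<alpha>, plus the
  Taylor constant \<open>L / 2\<close>.\<close>

definition mcrm_threshold :: "real \<Rightarrow> real \<Rightarrow> real \<Rightarrow> real \<Rightarrow> real \<Rightarrow> real" where
  "mcrm_threshold L \<alpha> \<sigma>1 \<kappa>G \<kappa>H = (let r = mcrm_growth_factor \<sigma>1 \<kappa>G \<kappa>H in
     12 * (\<alpha> * \<kappa>G * r ^ 2 + \<alpha> * \<kappa>H * r) + 6 * L)"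

text \<open>The exponent is \<open>-1\<close> for \<open>i = 0\<close>, whence the factor \<open>\<alpha>\<close>.\<close>

lemma inverse_powi_pred_le:
  fixes \<alpha> :: real
  assumes "\<alpha> > 1" "0 \<le> \<kappa>"
  shows "\<kappa> / \<alpha> powi (int i - 1) \<le> \<alpha> * \<kappa>"
proof -
  have "\<alpha> powi (-1) \<le> \<alpha> powi (int i - 1)"
    using assms by (intro power_int_increasing) auto
  then have "1 \<le> \<alpha> * \<alpha> powi (int i - 1)"
    using assms by (simp add: field_simps)
  then have "\<kappa> * 1 \<le> \<kappa> * (\<alpha> * \<alpha> powi (int i - 1))"
    using assms by (intro mult_left_mono) auto
  then show ?thesis using assms by (simp add: field_simps)
qed

text \<open>Since the model is nonpositive at \<open>y\<close>, Taylor's formula leaves the gain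
  \<open>\<alpha> ^ i * \<sigma> / 6\<close> on the cubed new step against the derivative errors.
  Applying \<open>cubic_young\<close> with \<open>c = \<sigma> / 12\<close> charges to the old step
  exactly what the acceptance test tolerates.\<close>

lemma mcrm_accept_if_threshold_le:
  fixes F :: "real ^ 'n \<Rightarrow> real ^ 'm"
  assumes C2: "\<And>j. twice_cont_diff (\<lambda>z. F z $ j)"
    and A1: "\<And>j y z. onorm ((*v) (hess (\<lambda>z. F z $ j) y - hess (\<lambda>z. F z $ j) z))
                        \<le> L * norm (y - z)"
    and "0 \<le> L" "\<alpha> > 1" "0 \<le> \<kappa>G" "0 \<le> \<kappa>H" "0 < \<sigma>1" "0 < \<sigma>"
    and start: "\<sigma>1 \<le> \<alpha> powi (int i - 1) * \<sigma>"
    and ok: "mcrm_derivatives_ok F \<alpha> \<kappa>G \<kappa>H xp xc i G H"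
    and step: "mcrm_step_ok \<theta> \<alpha> xc \<sigma> i G H y \<mu>"
    and large: "mcrm_threshold L \<alpha> \<sigma>1 \<kappa>G \<kappa>H \<le> \<alpha> ^ i * \<sigma>"
  shows "mcrm_accept F \<alpha> xp xc \<sigma> i y"
  unfolding mcrm_accept_def
proof
  fix j
  let ?f = "\<lambda>z. F z $ j"
  define \<beta> where "\<beta> = \<alpha> powi (int i - 1)"
  define d where "d = norm (xc - xp)"
  define s where "s = norm (y - xc)"
  define r where "r = mcrm_growth_factor \<sigma>1 \<kappa>G \<kappa>H"
  have "\<beta> > 0" using \<open>\<alpha> > 1\<close> by (simp add: \<beta>_def)
  have "0 \<le> s" "0 \<le> d" by (simp_all add: s_def d_def)
  have "1 \<le> r" using assms by (simp add: r_def mcrm_growth_factor_def)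
  have "model (G j) (H j) xc (\<alpha> ^ i * \<sigma>) y \<le> (MAX j. model (G j) (H j) xc (\<alpha> ^ i * \<sigma>) y)"
    by (rule Max_ge) auto
  then have model_le: "model (G j) (H j) xc (\<alpha> ^ i * \<sigma>) y \<le> 0"
    using step by (simp add: mcrm_step_ok_def)
  have "(grad ?f xc - G j) \<bullet> (y - xc) \<le> norm (grad ?f xc - G j) * s"
    unfolding s_def by (rule norm_cauchy_schwarz)
  also have "\<dots> \<le> \<kappa>G / \<beta> * d ^ 2 * s"
    using ok unfolding mcrm_derivatives_ok_def \<beta>_def d_def s_def by (intro mult_right_mono) auto
  finally have gradient_error: "grad ?f xc \<bullet> (y - xc) \<le> G j \<bullet> (y - xc) + \<kappa>G / \<beta> * d ^ 2 * s"
    by (simp add: inner_diff_left)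
  have "((hess ?f xc - H j) *v (y - xc)) \<bullet> (y - xc) \<le> onorm ((*v) (hess ?f xc - H j)) * s ^ 2"
    unfolding s_def using abs_quadratic_form_le_onorm[of "hess ?f xc - H j" "y - xc"] by linarith
  also have "\<dots> \<le> \<kappa>H / \<beta> * d * s ^ 2"
    using ok unfolding mcrm_derivatives_ok_def \<beta>_def d_def s_def by (intro mult_right_mono) auto
  finally have hessian_error: "(hess ?f xc *v (y - xc)) \<bullet> (y - xc)
      \<le> (H j *v (y - xc)) \<bullet> (y - xc) + \<kappa>H / \<beta> * d * s ^ 2"
    by (simp add: matrix_vector_mult_diff_rdistrib inner_diff_left)
  \<comment> \<open>The Hessian error enters Taylor's formula with the factor 1/2; nonnegativity
    allows dropping that factor, which yields the form of \<open>cubic_young\<close>.\<close>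
  have "0 \<le> \<kappa>H / \<beta> * d * s ^ 2"
    using \<open>0 \<le> \<kappa>H\<close> \<open>\<beta> > 0\<close> \<open>0 \<le> d\<close> by simp
  moreover have "?f y \<le> ?f xc + grad ?f xc \<bullet> (y - xc)
      + 1 / 2 * ((hess ?f xc *v (y - xc)) \<bullet> (y - xc)) + L / 2 * s ^ 3"
    unfolding s_def by (rule cubic_taylor_upper_bound[OF C2 A1 \<open>0 \<le> L\<close>])
  ultimately have descent: "?f y \<le> ?f xc + (\<kappa>G / \<beta> * d ^ 2 * s + \<kappa>H / \<beta> * d * s ^ 2)
      + (L / 2 - \<alpha> ^ i * \<sigma> / 6) * s ^ 3"
    using gradient_error hessian_error model_le
    unfolding model_def s_def[symmetric] left_diff_distrib by argo
  have "(\<kappa>G + \<kappa>H) * \<sigma>1 \<le> (\<kappa>G + \<kappa>H) * (\<beta> * \<sigma>)"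
    using start assms by (intro mult_left_mono) (auto simp: \<beta>_def)
  then have "\<kappa>G / \<beta> + \<kappa>H / \<beta> \<le> \<sigma> * ((\<kappa>G + \<kappa>H) / \<sigma>1)"
    using \<open>\<beta> > 0\<close> \<open>0 < \<sigma>1\<close> by (simp add: field_simps)
  also have "\<dots> \<le> \<sigma> / 12 * r"
    using \<open>0 < \<sigma>\<close> by (simp add: r_def mcrm_growth_factor_def algebra_simps)
  finally have "\<kappa>G / \<beta> * d ^ 2 * s + \<kappa>H / \<beta> * d * s ^ 2
      \<le> \<sigma> / 12 * d ^ 3 + (\<kappa>G / \<beta> * r ^ 2 + \<kappa>H / \<beta> * r) * s ^ 3"
    using assms \<open>\<beta> > 0\<close> \<open>0 \<le> s\<close> \<open>0 \<le> d\<close> \<open>1 \<le> r\<close> by (intro cubic_young) auto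
  also have "\<dots> \<le> \<sigma> / 12 * d ^ 3 + (\<alpha> * \<kappa>G * r ^ 2 + \<alpha> * \<kappa>H * r) * s ^ 3"
    using assms \<open>0 \<le> s\<close> \<open>1 \<le> r\<close> unfolding \<beta>_def
    by (intro add_left_mono mult_right_mono add_mono inverse_powi_pred_le) auto
  finally have "?f y \<le> ?f xc + \<sigma> / 12 * d ^ 3
      + (\<alpha> * \<kappa>G * r ^ 2 + \<alpha> * \<kappa>H * r + L / 2 - \<alpha> ^ i * \<sigma> / 6) * s ^ 3"
    using descent by (simp add: algebra_simps)
  \<comment> \<open>By \<open>large\<close>, half of the gain
    \<open>\<alpha> ^ i * \<sigma> / 6\<close> absorbs all error terms; the other half is what
    acceptance requires.\<close>
  also have "\<dots> \<le> ?f xc + \<sigma> / 12 * d ^ 3 + (- (\<alpha> ^ i * \<sigma> / 12)) * s ^ 3"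
    using large \<open>0 \<le> s\<close> unfolding mcrm_threshold_def r_def[symmetric] Let_def
    by (intro add_left_mono mult_right_mono) auto
  finally show "\<alpha> ^ i * \<sigma> / 12 * norm (y - xc) ^ 3 - \<sigma> / 12 * norm (xc - xp) ^ 3 \<le> F xc $ j - F y $ j"
    by (simp add: s_def d_def)
qed

section \<open>Approximate stationarity and Pareto criticality\<close>

text \<open>Each true gradient differs from the model gradient at \<open>y\<close> by four terms:
  Taylor remainder, gradient error, Hessian error and derivative of the cubic term. Their bound
  \<open>B\<close> is the same for all objectives, so it survives averaging with the weights
  \<open>\<mu>\<close>; approximate stationarity contributes the \<theta> term.\<close>

lemma mcrm_gradient_bound:
  fixes F :: "real ^ 'n \<Rightarrow> real ^ 'm"
  assumes C2: "\<And>j. twice_cont_diff (\<lambda>z. F z $ j)"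
    and A1: "\<And>j y z. onorm ((*v) (hess (\<lambda>z. F z $ j) y - hess (\<lambda>z. F z $ j) z))
                        \<le> L * norm (y - z)"
    and "0 \<le> L" "\<alpha> > 1" "0 \<le> \<kappa>G" "0 \<le> \<kappa>H" "0 < \<sigma>"
    and ok: "mcrm_derivatives_ok F \<alpha> \<kappa>G \<kappa>H xp xc i G H"
    and step: "mcrm_step_ok \<theta> \<alpha> xc \<sigma> i G H y \<mu>"
  shows "norm (\<Sum>j\<in>UNIV. \<mu> $ j *\<^sub>R grad (\<lambda>z. F z $ j) y)
    \<le> (\<theta> + L + \<alpha> ^ i * \<sigma> / 2) * norm (y - xc) ^ 2
      + \<alpha> * \<kappa>G * norm (xc - xp) ^ 2 + \<alpha> * \<kappa>H * norm (xc - xp) * norm (y - xc)"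
proof -
  define d where "d = norm (xc - xp)"
  define s where "s = norm (y - xc)"
  define gm where "gm = (\<lambda>j. grad (model (G j) (H j) xc (\<alpha> ^ i * \<sigma>)) y)"
  define B where "B = (L + \<alpha> ^ i * \<sigma> / 2) * s ^ 2 + \<alpha> * \<kappa>G * d ^ 2 + \<alpha> * \<kappa>H * d * s"
  have "0 \<le> s" "0 \<le> d" by (simp_all add: s_def d_def)
  have \<mu>: "\<And>j. 0 \<le> \<mu> $ j" "(\<Sum>j\<in>UNIV. \<mu> $ j) = 1"
    and stationary: "norm (\<Sum>j\<in>UNIV. \<mu> $ j *\<^sub>R gm j) \<le> \<theta> * s ^ 2"
    using step by (auto simp: mcrm_step_ok_def gm_def s_def)
  have err: "norm (grad (\<lambda>z. F z $ j) y - gm j) \<le> B" for j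
  proof -
    let ?f = "\<lambda>z. F z $ j"
    let ?v = "(\<alpha> ^ i * \<sigma> / 2 * norm (y - xc)) *\<^sub>R (y - xc)"
    have H: "transpose (H j) = H j"
      and G_err: "norm (grad ?f xc - G j) \<le> \<kappa>G / \<alpha> powi (int i - 1) * d ^ 2"
      and H_err: "onorm ((*v) (hess ?f xc - H j)) \<le> \<kappa>H / \<alpha> powi (int i - 1) * d"
      using ok by (auto simp: mcrm_derivatives_ok_def d_def)
    have "grad ?f y - gm j = (grad ?f y - grad ?f xc - hess ?f xc *v (y - xc))
        + (grad ?f xc - G j) + (hess ?f xc - H j) *v (y - xc) - ?v"
      unfolding gm_def grad_model[OF H] by (simp add: matrix_vector_mult_diff_rdistrib)
    then have "norm (grad ?f y - gm j) \<le> norm (grad ?f y - grad ?f xc - hess ?f xc *v (y - xc))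
        + norm (grad ?f xc - G j) + norm ((hess ?f xc - H j) *v (y - xc)) + norm ?v"
      by (smt (verit) norm_triangle_ineq norm_triangle_ineq4)
    moreover have "norm (grad ?f y - grad ?f xc - hess ?f xc *v (y - xc)) \<le> L * s ^ 2"
      unfolding s_def using C2 A1 \<open>0 \<le> L\<close> by (rule gradient_taylor_bound)
    moreover have "norm (grad ?f xc - G j) \<le> \<alpha> * \<kappa>G * d ^ 2"
      using G_err mult_right_mono[OF inverse_powi_pred_le[OF \<open>\<alpha> > 1\<close> \<open>0 \<le> \<kappa>G\<close>, of i], of "d ^ 2"]
      by simp
    moreover have "norm ((hess ?f xc - H j) *v (y - xc)) \<le> \<alpha> * \<kappa>H * d * s"
    proof -
      have "onorm ((*v) (hess ?f xc - H j)) \<le> \<alpha> * \<kappa>H * d"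
        using H_err mult_right_mono[OF inverse_powi_pred_le[OF \<open>\<alpha> > 1\<close> \<open>0 \<le> \<kappa>H\<close>, of i], of d] \<open>0 \<le> d\<close>
        by simp
      then show ?thesis
        using norm_matrix_vector_le_onorm[of "hess ?f xc - H j" "y - xc"]
          mult_right_mono[of _ "\<alpha> * \<kappa>H * d" s] \<open>0 \<le> s\<close> unfolding s_def by (meson order.trans)
    qed
    moreover have "norm ?v = \<alpha> ^ i * \<sigma> / 2 * s ^ 2"
      using assms by (simp add: s_def power2_eq_square)
    ultimately show ?thesis by (simp add: B_def algebra_simps)
  qed
  have "norm (\<Sum>j\<in>UNIV. \<mu> $ j *\<^sub>R (grad (\<lambda>z. F z $ j) y - gm j)) \<le> (\<Sum>j\<in>UNIV. \<mu> $ j * B)"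
    using err \<mu>(1) by (intro sum_norm_le) (auto intro!: mult_left_mono)
  also have "\<dots> = B" using \<mu>(2) by (simp flip: sum_distrib_right)
  finally have "norm (\<Sum>j\<in>UNIV. \<mu> $ j *\<^sub>R (grad (\<lambda>z. F z $ j) y - gm j)) \<le> B" .
  moreover have "(\<Sum>j\<in>UNIV. \<mu> $ j *\<^sub>R grad (\<lambda>z. F z $ j) y)
      = (\<Sum>j\<in>UNIV. \<mu> $ j *\<^sub>R (grad (\<lambda>z. F z $ j) y - gm j)) + (\<Sum>j\<in>UNIV. \<mu> $ j *\<^sub>R gm j)"
    by (simp add: scaleR_diff_right sum_subtractf)
  ultimately show ?thesis
    using stationary norm_triangle_ineq
      [of "\<Sum>j\<in>UNIV. \<mu> $ j *\<^sub>R (grad (\<lambda>z. F z $ j) y - gm j)" "\<Sum>j\<in>UNIV. \<mu> $ j *\<^sub>R gm j"]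
    by (simp add: B_def s_def d_def algebra_simps)
qed

text \<open>A single descent direction \<open>y - xs\<close> is used instead of a convergent
  subsequence of multipliers: by continuity it stays a descent direction, with a uniform margin, for
  the finitely many objectives at \<open>z k\<close>, so the averaged gradients cannot vanish in the
  limit.\<close>

lemma pareto_critical_if_multipliers_vanish:
  fixes F :: "real ^ 'n \<Rightarrow> real ^ 'm" and z :: "nat \<Rightarrow> real ^ 'n" and \<mu> :: "nat \<Rightarrow> real ^ 'm"
  assumes cont: "\<And>j. isCont (grad (\<lambda>z. F z $ j)) xs"
    and z: "z \<longlonglongrightarrow> xs"
    and \<mu>: "\<forall>\<^sub>F k in sequentially. (\<forall>j. 0 \<le> \<mu> k $ j) \<and> (\<Sum>j\<in>UNIV. \<mu> k $ j) = 1"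
    and lim: "(\<lambda>k. \<Sum>j\<in>UNIV. \<mu> k $ j *\<^sub>R grad (\<lambda>z. F z $ j) (z k)) \<longlonglongrightarrow> 0"
  shows "pareto_critical F xs"
  unfolding pareto_critical_def
proof (rule allI, rule ccontr)
  fix y
  define g where "g = (\<lambda>j. grad (\<lambda>z. F z $ j))"
  define m where "m = (MAX j. g j xs \<bullet> (y - xs))"
  assume "\<not> 0 \<le> (MAX j. grad (\<lambda>z. F z $ j) xs \<bullet> (y - xs))"
  then have "m < 0" by (simp add: m_def g_def del: Max_less_iff)
  have le_m: "g j xs \<bullet> (y - xs) \<le> m" for j unfolding m_def by (rule Max_ge) auto
  have "(\<lambda>k. g j (z k) \<bullet> (y - xs)) \<longlonglongrightarrow> g j xs \<bullet> (y - xs)" for j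
    unfolding g_def using isCont_tendsto_compose[OF cont z] by (intro tendsto_intros)
  \<comment> \<open>Passing from the negative maximum \<open>m\<close> to \<open>m / 2\<close>
    leaves room for continuity.\<close>
  moreover have "g j xs \<bullet> (y - xs) < m / 2" for j using le_m[of j] \<open>m < 0\<close> by linarith
  ultimately have "\<forall>\<^sub>F k in sequentially. g j (z k) \<bullet> (y - xs) < m / 2" for j
    by (rule order_tendstoD)
  then have "\<forall>\<^sub>F k in sequentially. \<forall>j. g j (z k) \<bullet> (y - xs) < m / 2"
    by (rule eventually_all_finite)
  with \<mu> have "\<forall>\<^sub>F k in sequentially. (\<Sum>j\<in>UNIV. \<mu> k $ j *\<^sub>R g j (z k)) \<bullet> (y - xs) \<le> m / 2"
  proof eventually_elim
    case (elim k)
    have "(\<Sum>j\<in>UNIV. \<mu> k $ j *\<^sub>R g j (z k)) \<bullet> (y - xs) = (\<Sum>j\<in>UNIV. \<mu> k $ j * (g j (z k) \<bullet> (y - xs)))"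
      by (simp add: inner_sum_left)
    also have "\<dots> \<le> (\<Sum>j\<in>UNIV. \<mu> k $ j * (m / 2))"
      using elim by (intro sum_mono mult_left_mono) (auto intro: less_imp_le)
    also have "\<dots> = m / 2" using elim by (simp flip: sum_distrib_right sum_divide_distrib)
    finally show ?case .
  qed
  moreover have "(\<lambda>k. (\<Sum>j\<in>UNIV. \<mu> k $ j *\<^sub>R g j (z k)) \<bullet> (y - xs)) \<longlonglongrightarrow> 0 \<bullet> (y - xs)"
    using lim unfolding g_def by (intro tendsto_intros)
  ultimately have "0 \<bullet> (y - xs) \<le> m / 2"
    using tendsto_upperbound by fastforce
  then show False using \<open>m < 0\<close> by simp
qed

section \<open>Convergence of the run\<close>

theorem corollary3p4:
  fixes F :: "real ^ 'n \<Rightarrow> real ^ 'm"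
    and L Fstar :: "'m \<Rightarrow> real"
    and x :: "nat \<Rightarrow> real ^ 'n" and lam :: "nat \<Rightarrow> real ^ 'm" and \<sigma> :: "nat \<Rightarrow> real"
    and \<theta> \<alpha> \<kappa>G \<kappa>H :: real
  assumes C2: "\<And>j. twice_cont_diff (\<lambda>z. F z $ j)"
    and A1: "\<And>j y z. onorm ((*v) (hess (\<lambda>z. F z $ j) y - hess (\<lambda>z. F z $ j) z))
                        \<le> L j * norm (y - z)"
    and A2: "\<And>j y. F y $ j \<ge> Fstar j"
    and run: "mcrm_generates F \<theta> \<alpha> \<kappa>G \<kappa>H x lam \<sigma>"
  shows "(\<lambda>t. norm (x t - x (t - 1))) \<longlonglongrightarrow> 0 \<and>
         (\<lambda>t. norm (\<Sum>j\<in>UNIV. lam t $ j *\<^sub>R grad (\<lambda>z. F z $ j) (x t))) \<longlonglongrightarrow> 0 \<and>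
         (\<forall>xs r. strict_mono r \<longrightarrow> (x \<circ> r) \<longlonglongrightarrow> xs \<longrightarrow> pareto_critical F xs)"
proof -
  \<comment> \<open>The sum of absolute values stands in for the maximum: it dominates every
    \<open>L j\<close> and is nonnegative by construction.\<close>
  define Lm where "Lm = (\<Sum>j\<in>UNIV. \<bar>L j\<bar>)"
  have "0 \<le> Lm" by (simp add: Lm_def sum_nonneg)
  have A1': "onorm ((*v) (hess (\<lambda>z. F z $ j) y - hess (\<lambda>z. F z $ j) z)) \<le> Lm * norm (y - z)"
    for j y z
  proof -
    have "L j \<le> Lm"
      using member_le_sum[of j UNIV "\<lambda>j. \<bar>L j\<bar>"] by (simp add: Lm_def)
    then show ?thesis using A1[of j y z] mult_right_mono[of "L j" Lm "norm (y - z)"] by simp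
  qed
  define i0 where "i0 = (\<lambda>t. mcrm_first_index \<alpha> (\<sigma> 1) (\<sigma> t))"
  have par: "0 < \<sigma> 1" "0 \<le> \<theta>" "1 < \<alpha>" "0 \<le> \<kappa>G" "0 \<le> \<kappa>H"
    using run by (auto simp: mcrm_generates_def)
  from run obtain it G H y \<mu> where R: "\<forall>t\<ge>1.
        i0 t \<le> it t \<and>
        (\<forall>k\<in>{i0 t..it t}.
           mcrm_derivatives_ok F \<alpha> \<kappa>G \<kappa>H (x (t - 1)) (x t) k (G t k) (H t k) \<and>
           mcrm_step_ok \<theta> \<alpha> (x t) (\<sigma> t) k (G t k) (H t k) (y t k) (\<mu> t k) \<and>
           (mcrm_accept F \<alpha> (x (t - 1)) (x t) (\<sigma> t) k (y t k) \<longleftrightarrow> k = it t)) \<and>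
        x (t + 1) = y t (it t) \<and> lam (t + 1) = \<mu> t (it t) \<and>
        \<sigma> (t + 1) = \<alpha> powi (int (it t) - 1) * \<sigma> t"
    unfolding mcrm_generates_def i0_def by (elim conjE exE) blast
  have it_ge: "i0 t \<le> it t"
    and derivs: "\<And>k. i0 t \<le> k \<Longrightarrow> k \<le> it t \<Longrightarrow>
      mcrm_derivatives_ok F \<alpha> \<kappa>G \<kappa>H (x (t - 1)) (x t) k (G t k) (H t k)"
    and trial: "\<And>k. i0 t \<le> k \<Longrightarrow> k \<le> it t \<Longrightarrow>
      mcrm_step_ok \<theta> \<alpha> (x t) (\<sigma> t) k (G t k) (H t k) (y t k) (\<mu> t k)"
    and acc: "\<And>k. i0 t \<le> k \<Longrightarrow> k \<le> it t \<Longrightarrow>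
      mcrm_accept F \<alpha> (x (t - 1)) (x t) (\<sigma> t) k (y t k) \<longleftrightarrow> k = it t"
    and upd: "y t (it t) = x (Suc t)" "\<mu> t (it t) = lam (Suc t)"
      "\<sigma> (Suc t) = \<alpha> powi (int (it t) - 1) * \<sigma> t"
    if "1 \<le> t" for t
    using R that by auto
  have \<sigma>_ge: "\<sigma> 1 \<le> \<sigma> t" if "1 \<le> t" for t
    using that
  proof (induction t rule: dec_induct)
    case (step t)
    then show ?case
      using mcrm_first_index_le_mono[of \<alpha> "\<sigma> t" "\<sigma> 1" "it t"] it_ge[of t] upd(3)[of t] par
      by (simp add: i0_def)
  qed simp
  have \<sigma>_pos: "0 < \<sigma> t" if "1 \<le> t" for t
    using \<sigma>_ge[OF that] par by linarith
  have \<sigma>_step: "\<alpha> ^ it t * \<sigma> t = \<alpha> * \<sigma> (Suc t)" if "1 \<le> t" for t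
    using power_int_add_1'[of \<alpha> "int (it t) - 1"] upd(3)[OF that] par by simp
  define d where "d = (\<lambda>t. norm (x t - x (t - 1)))"
  have d_Suc: "norm (x (Suc t) - x t) = d (Suc t)" for t by (simp add: d_def)
  \<comment> \<open>One arbitrary objective suffices for the Lyapunov function.
    \<open>\<Phi>\<close> is shifted by one index because the run constrains \<open>\<sigma>\<close>
    only from index 1 on.\<close>
  obtain j :: 'm where True by blast
  define \<Phi> where "\<Phi> = (\<lambda>t. F (x (Suc t)) $ j + \<sigma> (Suc t) / 12 * d (Suc t) ^ 3)"
  define c where "c = (\<alpha> - 1) * \<sigma> 1 / 12"
  have "0 < c" using par by (simp add: c_def)
  have dec: "c * d (Suc (Suc t)) ^ 3 \<le> \<Phi> t - \<Phi> (Suc t)" for t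
  proof -
    let ?t = "Suc t"
    have "mcrm_accept F \<alpha> (x (?t - 1)) (x ?t) (\<sigma> ?t) (it ?t) (y ?t (it ?t))"
      using acc[of ?t "it ?t"] it_ge[of ?t] by simp
    then have "\<alpha> * \<sigma> (Suc ?t) / 12 * d (Suc ?t) ^ 3 - \<sigma> ?t / 12 * d ?t ^ 3
        \<le> F (x ?t) $ j - F (x (Suc ?t)) $ j"
      using \<sigma>_step[of ?t] upd(1)[of ?t] by (simp add: mcrm_accept_def d_def)
    \<comment> \<open>Of the factor \<alpha> in front of the new cube, one unit enters
      \<open>\<Phi> (Suc t)\<close>; the surplus \<open>\<alpha> - 1\<close> is the
      decrease.\<close>
    moreover have "c * d (Suc ?t) ^ 3 \<le> (\<alpha> - 1) * \<sigma> (Suc ?t) / 12 * d (Suc ?t) ^ 3"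
      using \<sigma>_ge[of "Suc ?t"] par by (intro mult_right_mono) (auto simp: c_def d_def)
    ultimately show ?thesis by (simp add: \<Phi>_def algebra_simps diff_divide_distrib)
  qed
  have "decseq \<Phi>"
  proof (rule decseq_SucI)
    fix t
    have "0 \<le> c * d (Suc (Suc t)) ^ 3" using \<open>0 < c\<close> by (simp add: d_def)
    with dec[of t] show "\<Phi> (Suc t) \<le> \<Phi> t" by linarith
  qed
  moreover have "\<forall>t. Fstar j \<le> \<Phi> t"
  proof
    fix t
    have "0 \<le> \<sigma> (Suc t) / 12 * d (Suc t) ^ 3" using \<sigma>_pos[of "Suc t"] by (simp add: d_def)
    with A2[of j "x (Suc t)"] show "Fstar j \<le> \<Phi> t" unfolding \<Phi>_def by linarith
  qed
  ultimately obtain l where "\<Phi> \<longlonglongrightarrow> l" by (rule decseq_convergent)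
  \<comment> \<open>Consecutive differences of a convergent sequence tend to zero, so the cubes are
    squeezed to zero without summing them.\<close>
  then have "(\<lambda>t. (\<Phi> t - \<Phi> (Suc t)) / c) \<longlonglongrightarrow> (l - l) / c"
    using \<open>0 < c\<close> by (intro tendsto_intros LIMSEQ_Suc) auto
  then have lim0: "(\<lambda>t. (\<Phi> t - \<Phi> (Suc t)) / c) \<longlonglongrightarrow> 0" by simp
  have "(\<lambda>t. d (Suc (Suc t)) ^ 3) \<longlonglongrightarrow> 0"
  proof (rule tendsto_sandwich[OF _ _ tendsto_const lim0])
    show "\<forall>\<^sub>F t in sequentially. d (Suc (Suc t)) ^ 3 \<le> (\<Phi> t - \<Phi> (Suc t)) / c"
      using dec \<open>0 < c\<close> by (simp add: field_simps)
  qed (simp add: d_def)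
  then have d_lim: "d \<longlonglongrightarrow> 0"
    by (simp add: filterlim_sequentially_Suc[of d] filterlim_sequentially_Suc[of "\<lambda>t. d (Suc t)"])

  \<comment> \<open>The first entry covers the initial parameter and acceptance at a positive first
    exponent; the second covers acceptance after a rejected trial.\<close>
  define K where "K = max (\<alpha> * \<sigma> 1) (mcrm_threshold Lm \<alpha> (\<sigma> 1) \<kappa>G \<kappa>H)"
  have \<sigma>_le: "\<sigma> t \<le> K" if "1 \<le> t" for t
    using that
  proof (induction t rule: dec_induct)
    case base
    show ?case using par by (simp add: K_def le_max_iff_disj)
  next
    case (step t)
    then have t: "1 \<le> t" by simp
    show ?case
    proof (cases "it t = i0 t")
      case True
      show ?thesis
      proof (cases "i0 t")
        case 0
        \<comment> \<open>Acceptance at exponent 0 is the only case in which the parameter shrinks: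
          the update exponent is -1.\<close>
        then have "\<sigma> (Suc t) = \<sigma> t / \<alpha>" using True upd(3)[OF t] by (simp add: field_simps)
        also have "\<dots> \<le> \<sigma> t" using \<sigma>_pos[OF t] par by (simp add: field_simps)
        finally show ?thesis using step.IH by simp
      next
        case (Suc k)
        then show ?thesis
          using mcrm_first_index_Suc_less[OF \<open>1 < \<alpha>\<close>, of "\<sigma> 1" "\<sigma> t" k] True upd(3)[OF t]
          by (simp add: i0_def K_def)
      qed
    next
      case False
      \<comment> \<open>The last rejected trial. Its parameter
        \<open>\<alpha> ^ k * \<sigma> t\<close> is exactly \<open>\<sigma> (Suc t)\<close>, so
        rejection puts the new parameter below the threshold.\<close>
      define k where "k = it t - 1"
      have k: "i0 t \<le> k" "k \<le> it t" "it t = Suc k"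
        using False it_ge[OF t] by (auto simp: k_def)
      have "\<sigma> 1 \<le> \<alpha> powi (int k - 1) * \<sigma> t"
        using k(1) par \<sigma>_pos[OF t] by (intro mcrm_first_index_le_mono) (auto simp: i0_def)
      moreover have "\<not> mcrm_accept F \<alpha> (x (t - 1)) (x t) (\<sigma> t) k (y t k)"
        using acc[OF t k(1,2)] k(3) by simp
      ultimately have "\<alpha> ^ k * \<sigma> t < mcrm_threshold Lm \<alpha> (\<sigma> 1) \<kappa>G \<kappa>H"
        using mcrm_accept_if_threshold_le[OF C2 A1' \<open>0 \<le> Lm\<close> par(3,4,5,1) \<sigma>_pos[OF t] _
            derivs[OF t k(1,2)] trial[OF t k(1,2)]] by fastforce
      then show ?thesis using upd(3)[OF t] k(3) by (simp add: K_def)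
    qed
  qed

  define g where "g = (\<lambda>t. \<Sum>j\<in>UNIV. lam t $ j *\<^sub>R grad (\<lambda>z. F z $ j) (x t))"
  \<comment> \<open>The bound of \<open>mcrm_gradient_bound\<close> with
    \<open>\<alpha> ^ it t * \<sigma> t = \<alpha> * \<sigma> (Suc t)\<close> replaced by
    \<open>\<alpha> * K\<close>; every term is then quadratic in step lengths with fixed
    coefficients.\<close>
  define B where "B = (\<lambda>t. (\<theta> + Lm + \<alpha> * K / 2) * d (Suc t) ^ 2
      + \<alpha> * \<kappa>G * d t ^ 2 + \<alpha> * \<kappa>H * d t * d (Suc t))"
  have g_le: "norm (g (Suc t)) \<le> B t" if t: "1 \<le> t" for t
  proof -
    have "norm (g (Suc t)) \<le> (\<theta> + Lm + \<alpha> * \<sigma> (Suc t) / 2) * d (Suc t) ^ 2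
      + \<alpha> * \<kappa>G * d t ^ 2 + \<alpha> * \<kappa>H * d t * d (Suc t)"
      using mcrm_gradient_bound[OF C2 A1' \<open>0 \<le> Lm\<close> par(3,4,5) \<sigma>_pos[OF t]
          derivs[OF t it_ge[OF t] order_refl] trial[OF t it_ge[OF t] order_refl]]
      unfolding upd(1,2)[OF t] \<sigma>_step[OF t] by (simp add: g_def d_def)
    also have "\<dots> \<le> B t"
      unfolding B_def using \<sigma>_le[of "Suc t"] par
      by (intro add_right_mono mult_right_mono add_left_mono divide_right_mono mult_left_mono) auto
    finally show ?thesis .
  qed
  have "B \<longlonglongrightarrow> (\<theta> + Lm + \<alpha> * K / 2) * 0 ^ 2 + \<alpha> * \<kappa>G * 0 ^ 2 + \<alpha> * \<kappa>H * 0 * 0"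
    unfolding B_def by (intro tendsto_intros d_lim LIMSEQ_Suc)
  then have "B \<longlonglongrightarrow> 0" by simp
  then have "(\<lambda>t. g (Suc t)) \<longlonglongrightarrow> 0"
    by (rule Lim_null_comparison[rotated]) (use g_le in \<open>auto simp: eventually_sequentially\<close>)
  then have g_lim: "g \<longlonglongrightarrow> 0" by (simp add: filterlim_sequentially_Suc)

  \<comment> \<open>The first computed multiplier is \<open>lam 2\<close>, so the simplex
    constraints hold only eventually.\<close>
  have lam: "(\<forall>j. 0 \<le> lam t $ j) \<and> (\<Sum>j\<in>UNIV. lam t $ j) = 1" if "2 \<le> t" for t
  proof -
    obtain u where u: "t = Suc u" "1 \<le> u" using \<open>2 \<le> t\<close> by (cases t) auto
    show ?thesis
      using trial[OF u(2) it_ge[OF u(2)] order_refl] u by (simp add: mcrm_step_ok_def upd)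
  qed
  have "pareto_critical F xs" if r: "strict_mono r" and lim: "(x \<circ> r) \<longlonglongrightarrow> xs" for xs r
  proof (rule pareto_critical_if_multipliers_vanish)
    show "isCont (grad (\<lambda>z. F z $ j)) xs" for j
      using C2 by (simp add: twice_cont_diff_def differentiable_imp_continuous_within)
    show "(x \<circ> r) \<longlonglongrightarrow> xs" by (rule lim)
    have "\<forall>\<^sub>F t in sequentially. (\<forall>j. 0 \<le> lam t $ j) \<and> (\<Sum>j\<in>UNIV. lam t $ j) = 1"
      using lam by (auto simp: eventually_sequentially)
    then show "\<forall>\<^sub>F k in sequentially. (\<forall>j. 0 \<le> (lam \<circ> r) k $ j) \<and> (\<Sum>j\<in>UNIV. (lam \<circ> r) k $ j) = 1"
      using eventually_subseq[OF r] by fastforce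
    show "(\<lambda>k. \<Sum>j\<in>UNIV. (lam \<circ> r) k $ j *\<^sub>R grad (\<lambda>z. F z $ j) ((x \<circ> r) k)) \<longlonglongrightarrow> 0"
      using LIMSEQ_subseq_LIMSEQ[OF g_lim r] by (simp add: g_def o_def)
  qed
  moreover have "(\<lambda>t. norm (g t)) \<longlonglongrightarrow> 0" using g_lim by (rule tendsto_norm_zero)
  ultimately show ?thesis using d_lim by (simp add: d_def g_def)
qed

end
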